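(* Let $F:\Delta\to\mathbb R^n$ be smooth. For $\sigma^\star\in\Delta$, the following statements are equivalent. (i) $\sigma^\star$ is a solution of ${\rm VI}(F,\Delta)$. (ii) $\sigma^\star$ is an optimizer of the linear program, in the variable $\hat\sigma\in\mathbb R^n$ and parameterized by $\sigma=\sigma^\star$, $$\min_{\hat\sigma}\ \hat\sigma^\top F(\sigma)\quad\text{s.t.}\quad \mathbf 1^\top\hat\sigma=1,\ \hat\sigma\ge0 .$$ (iii) $\sigma^\star$ satisfies the $\mu=0$ case of the fixed-point KKT system for some $v\in\mathbb R$ and some $r\in\mathbb R^n$ with $r\ge0$; that is, with $\hat\sigma=\sigma=\sigma^\star$ and $\mu=0$, $$\hat\sigma\circ r-\mu=0,\qquad r-F(\sigma)-v\mathbf 1=0,\qquad \mathbf 1^\top\hat\sigma-1=0 .$$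
   Context: $\Delta=\{\sigma\in\mathbb R^n:\sigma\ge0,\ \mathbf 1^\top\sigma=1\}$ is the standard simplex and $\mathbf 1$ is the all-ones vector. $\circ$ is the componentwise product and vector inequalities are componentwise. A solution of ${\rm VI}(F,\Delta)$ is a point $\sigma^\star\in\Delta$ with $\langle F(\sigma^\star),\sigma'-\sigma^\star\rangle\ge0$ for all $\sigma'\in\Delta$. *)

theory Defs
  imports "HOL-Analysis.Analysis"
begin

text \<open>Vectors are of type \<^typ>\<open>real ^ 'n\<close>. The library instances of the algebraic and order classes
  are componentwise: \<open>x * y\<close> is the componentwise product, \<open>1\<close> the all-ones vector, and
  \<open>0 \<le> x\<close> says that every component is nonnegative.\<close>

definition std_simplex :: "(real ^ 'n) set" where
  "std_simplex = {\<sigma>. 0 \<le> \<sigma> \<and> 1 \<bullet> \<sigma> = 1}"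

text \<open>\<open>k\<close>-fold continuous differentiability by iterated partial derivatives; only meaningful for
  open \<open>U\<close>, as the derivatives are taken at \<open>at x\<close> rather than \<open>at x within U\<close>.\<close>

primrec Ck_on :: "nat \<Rightarrow> 'a::euclidean_space set \<Rightarrow> ('a \<Rightarrow> 'b::real_normed_vector) \<Rightarrow> bool" where
  "Ck_on 0 U f \<longleftrightarrow> continuous_on U f"
| "Ck_on (Suc k) U f \<longleftrightarrow> (\<forall>x\<in>U. f differentiable (at x)) \<and>
     (\<forall>b\<in>Basis. Ck_on k U (\<lambda>x. frechet_derivative f (at x) b))"

text \<open>Smoothness on an arbitrary set: near each point of \<open>S\<close>, \<open>f\<close> agrees on \<open>S\<close> with a
  \<open>C\<^sup>\<infinity>\<close> function on an open set. Values of \<open>f\<close> outside \<open>S\<close> are irrelevant.\<close>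

definition smooth_on_set :: "'a::euclidean_space set \<Rightarrow> ('a \<Rightarrow> 'b::real_normed_vector) \<Rightarrow> bool" where
  "smooth_on_set S f \<longleftrightarrow> (\<forall>x\<in>S. \<exists>U g. open U \<and> x \<in> U \<and> (\<forall>k. Ck_on k U g) \<and> (\<forall>y\<in>S \<inter> U. f y = g y))"

definition VI_solution :: "(real ^ 'n \<Rightarrow> real ^ 'n) \<Rightarrow> (real ^ 'n) set \<Rightarrow> real ^ 'n \<Rightarrow> bool" where
  "VI_solution F K s \<longleftrightarrow> s \<in> K \<and> (\<forall>s'\<in>K. F s \<bullet> (s' - s) \<ge> 0)"

definition LP_optimizer :: "(real ^ 'n \<Rightarrow> real ^ 'n) \<Rightarrow> real ^ 'n \<Rightarrow> real ^ 'n \<Rightarrow> bool" where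
  "LP_optimizer F \<sigma> s \<longleftrightarrow> is_arg_min (\<lambda>\<sigma>'. \<sigma>' \<bullet> F \<sigma>) (\<lambda>\<sigma>'. 1 \<bullet> \<sigma>' = 1 \<and> 0 \<le> \<sigma>') s"

text \<open>The fixed-point KKT system has two vector arguments: \<open>\<sigma>\<close>, at which \<open>F\<close> is evaluated,
  and the program's variable \<open>s\<close>; the sign constraint on \<open>r\<close> is not part of the system.\<close>

definition KKT_system ::
  "(real ^ 'n \<Rightarrow> real ^ 'n) \<Rightarrow> real ^ 'n \<Rightarrow> real ^ 'n \<Rightarrow> real ^ 'n \<Rightarrow> real ^ 'n \<Rightarrow> real \<Rightarrow> bool" where
  "KKT_system F \<mu> \<sigma> s r v \<longleftrightarrow>
     s * r - \<mu> = 0 \<and> r - F \<sigma> - v *\<^sub>R 1 = 0 \<and> 1 \<bullet> s - 1 = 0"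

end

theory Submission
  imports Defs
begin

text \<open>For \<open>s\<close> in the simplex, the multiplier in (iii) is forced to be \<open>v = - s \<bullet> F s\<close>: then
  \<open>r = F s + v 1\<close> is nonnegative because the vertices of the simplex do not beat \<open>s\<close>, and
  complementarity follows because \<open>s \<bullet> r = 0\<close> is a sum of nonnegative terms.\<close>

lemma inner_nonneg_vec:
  fixes x y :: "real ^ 'n"
  assumes "0 \<le> x" "0 \<le> y"
  shows "0 \<le> x \<bullet> y"
  using assms by (auto simp: inner_vec_def less_eq_vec_def intro!: sum_nonneg)

text \<open>Links the componentwise complementarity of the KKT system to the single scalar equation
  that optimality yields; both directions of the KKT equivalence use it.\<close>

lemma inner_eq_0_iff_times_eq_0_vec:
  fixes x y :: "real ^ 'n"
  assumes "0 \<le> x" "0 \<le> y"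
  shows "x \<bullet> y = 0 \<longleftrightarrow> x * y = 0"
proof -
  have "x \<bullet> y = 0 \<longleftrightarrow> (\<forall>i\<in>UNIV. x $ i * y $ i = 0)"
    unfolding inner_vec_def inner_real_def
    using assms by (intro sum_nonneg_eq_0_iff) (auto simp: less_eq_vec_def)
  then show ?thesis
    by (simp add: vec_eq_iff)
qed

lemma axis_in_std_simplex: "axis i 1 \<in> (std_simplex :: (real ^ 'n) set)"
  by (auto simp: std_simplex_def less_eq_vec_def inner_axis) (simp add: axis_def)

lemma LP_optimizer_iff:
  "LP_optimizer F \<sigma> s \<longleftrightarrow>
     s \<in> std_simplex \<and> (\<forall>s'\<in>std_simplex. s \<bullet> F \<sigma> \<le> s' \<bullet> F \<sigma>)"
  by (auto simp: LP_optimizer_def is_arg_min_linorder std_simplex_def)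

text \<open>With the cost frozen at \<open>F s\<close>, the objective is linear, so its increment
  from \<open>s\<close> to \<open>s'\<close> is exactly the inner product in the variational
  inequality.\<close>

lemma VI_solution_iff_LP_optimizer:
  "VI_solution F std_simplex s \<longleftrightarrow> LP_optimizer F s s"
  by (auto simp: VI_solution_def LP_optimizer_iff inner_diff_right inner_commute)

text \<open>This is linear programming optimality for a fixed cost vector \<open>F \<sigma>\<close>.
  No fixed point is involved, so \<sigma> stays independent of \<open>s\<close>.\<close>

lemma KKT_system_0_iff_LP_optimizer:
  assumes s: "s \<in> std_simplex"
  shows "(\<exists>v r. 0 \<le> r \<and> KKT_system F 0 \<sigma> s r v) \<longleftrightarrow> LP_optimizer F \<sigma> s"
proof
  assume "\<exists>v r. 0 \<le> r \<and> KKT_system F 0 \<sigma> s r v"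
  then obtain v r where r: "0 \<le> r" and sr: "s * r = 0" and F: "F \<sigma> = r - v *\<^sub>R 1"
    by (auto simp: KKT_system_def algebra_simps)
  \<comment> \<open>On the simplex the objective differs from \<open>s' \<bullet> r\<close> only by
    the constant \<open>v\<close>, so it suffices that \<open>s' \<bullet> r\<close> is bounded
    below by 0 and attains 0 at \<open>s\<close>.\<close>
  have F_inner: "s' \<bullet> F \<sigma> = s' \<bullet> r - v" if "s' \<in> std_simplex" for s'
    using that by (simp add: F std_simplex_def inner_diff_right inner_commute)
  have "s \<bullet> r = 0"
    using s r sr inner_eq_0_iff_times_eq_0_vec by (auto simp: std_simplex_def)
  moreover have "0 \<le> s' \<bullet> r" if "s' \<in> std_simplex" for s'
    using that r by (auto simp: std_simplex_def intro: inner_nonneg_vec)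
  ultimately show "LP_optimizer F \<sigma> s"
    using s by (auto simp: LP_optimizer_iff F_inner)
next
  assume lp: "LP_optimizer F \<sigma> s"
  define v where "v = - (s \<bullet> F \<sigma>)"
  define r where "r = F \<sigma> + v *\<^sub>R 1"
  \<comment> \<open>At the vertex \<open>axis i 1\<close> the objective is the i-th entry of the
    cost.\<close>
  have "s \<bullet> F \<sigma> \<le> F \<sigma> $ i" for i
    using lp axis_in_std_simplex[of i] by (auto simp: LP_optimizer_iff inner_axis')
  then have r: "0 \<le> r"
    by (simp add: r_def v_def less_eq_vec_def)
  \<comment> \<open>Since \<open>1 \<bullet> s = 1\<close>, the term \<open>v *\<^sub>R 1\<close>
    contributes exactly \<open>v\<close>, which cancels
    \<open>s \<bullet> F \<sigma>\<close>.\<close>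
  have "s \<bullet> r = 0"
    using s by (simp add: r_def v_def std_simplex_def inner_diff_right inner_commute[of s 1])
  then have "s * r = 0"
    using s r inner_eq_0_iff_times_eq_0_vec by (auto simp: std_simplex_def)
  then have "KKT_system F 0 \<sigma> s r v"
    using s by (simp add: KKT_system_def r_def std_simplex_def)
  with r show "\<exists>v r. 0 \<le> r \<and> KKT_system F 0 \<sigma> s r v"
    by blast
qed

theorem theorem2:
  fixes F :: "real ^ 'n \<Rightarrow> real ^ 'n" and \<sigma>s :: "real ^ 'n"
  assumes "smooth_on_set std_simplex F"
    and "\<sigma>s \<in> std_simplex"
  shows "(VI_solution F std_simplex \<sigma>s \<longleftrightarrow> LP_optimizer F \<sigma>s \<sigma>s) \<and>
    (LP_optimizer F \<sigma>s \<sigma>s \<longleftrightarrow> (\<exists>v r. 0 \<le> r \<and> KKT_system F 0 \<sigma>s \<sigma>s r v))"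
  using VI_solution_iff_LP_optimizer KKT_system_0_iff_LP_optimizer[OF assms(2)] by blast

end
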